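(* The generating function $G(x,y)=\sum_{n,p\ge 0}\mathrm{OCPS}^{(n+1)}(p+1)\,x^n y^p$ of the numbers of order-consecutive partition sequences is the rational function $$G(x,y)=\frac{1-x}{1-2x-2xy+x^2+x^2y}$$ (as an identity of formal power series in $x$ with coefficients in polynomials in $y$).
   Context: For integers $m,q\ge1$, a partition sequence of $\{1,\dots,m\}$ into $q$ parts is an ordered tuple $(s_1,\dots,s_q)$ of nonempty pairwise disjoint sets with union $\{1,\dots,m\}$. It is order-consecutive if for every $k=1,\dots,q$ the union $\bigcup_{i=1}^k s_i$ is a set of consecutive integers. $\mathrm{OCPS}^{(m)}(q)$ denotes the number of order-consecutive partition sequences of $\{1,\dots,m\}$ into $q$ parts (so it is $0$ for $q>m$). *)

theory Defs
  imports "HOL-Computational_Algebra.Computational_Algebra"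
begin

(* The tuple (s_1, ..., s_q) is the list ss, with s_(i+1) = ss ! i. *)
definition partition_sequence :: "nat \<Rightarrow> nat \<Rightarrow> nat set list \<Rightarrow> bool" where
  "partition_sequence m q ss \<longleftrightarrow>
     length ss = q \<and>
     (\<forall>i<q. ss ! i \<noteq> {}) \<and>
     (\<forall>i<q. \<forall>j<q. i \<noteq> j \<longrightarrow> ss ! i \<inter> ss ! j = {}) \<and>
     (\<Union>i<q. ss ! i) = {1..m}"

definition consecutive_integers :: "nat set \<Rightarrow> bool" where
  "consecutive_integers S \<longleftrightarrow> (\<exists>a b. S = {a..b})"

definition order_consecutive :: "nat set list \<Rightarrow> bool" where
  "order_consecutive ss \<longleftrightarrow>
     (\<forall>k\<in>{1..length ss}. consecutive_integers (\<Union>i<k. ss ! i))"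

definition OCPS :: "nat \<Rightarrow> nat \<Rightarrow> nat" where
  "OCPS m q = card {ss. partition_sequence m q ss \<and> order_consecutive ss}"

lemma finite_partition_sequences: "finite {ss. partition_sequence m q ss}"
proof (rule finite_subset)
  show "{ss. partition_sequence m q ss} \<subseteq> {ss. set ss \<subseteq> Pow {1..m} \<and> length ss = q}"
  proof (intro subsetI CollectI conjI)
    fix ss A assume *: "ss \<in> {ss. partition_sequence m q ss}" and "A \<in> set ss"
    then obtain i where "i < q" "A = ss ! i"
      by (auto simp: partition_sequence_def in_set_conv_nth)
    then have "A \<subseteq> (\<Union>i<q. ss ! i)" by blast
    with * show "A \<in> Pow {1..m}" by (simp add: partition_sequence_def)
  qed (simp add: partition_sequence_def)
  show "finite {ss. set ss \<subseteq> Pow {1..m} \<and> length ss = q}"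
    by (rule finite_lists_length_eq) simp
qed

lemma partition_sequence_imp_le:
  assumes "partition_sequence m q ss"
  shows "q \<le> m"
proof -
  have un: "(\<Union>i<q. ss ! i) = {1..m}"
    using assms by (simp add: partition_sequence_def)
  have fin: "finite (ss ! i)" if "i < q" for i
    by (rule finite_subset[of _ "{1..m}"]) (use un that in auto)
  have pos: "card (ss ! i) \<ge> 1" if "i < q" for i
    using assms that fin[OF that] by (simp add: partition_sequence_def Suc_le_eq card_gt_0_iff)
  have "q = (\<Sum>i<q. 1)" by simp
  also have "\<dots> \<le> (\<Sum>i<q. card (ss ! i))"
    by (rule sum_mono) (use pos in auto)
  also have "\<dots> = card (\<Union>i<q. ss ! i)"
    by (rule card_UN_disjoint [symmetric])
       (use assms fin in \<open>auto simp: partition_sequence_def\<close>)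
  also have "\<dots> = m" by (simp add: un)
  finally show ?thesis .
qed

lemma OCPS_eq_0:
  assumes "m < q"
  shows "OCPS m q = 0"
proof -
  have "{ss. partition_sequence m q ss \<and> order_consecutive ss} = {}"
    using assms partition_sequence_imp_le[of m q] by auto
  then show ?thesis by (simp only: OCPS_def card.empty)
qed

(* G as a power series in x over the ring Z[y].  The inner sum over p may stop at n because
   OCPS (n+1) (p+1) = 0 for p > n; coeff_OCPS_gf gives the coefficient for all n and p. *)
definition OCPS_gf :: "int poly fps" where
  "OCPS_gf = Abs_fps (\<lambda>n. \<Sum>p\<le>n. monom (int (OCPS (n + 1) (p + 1))) p)"

lemma coeff_OCPS_gf: "coeff (fps_nth OCPS_gf n) p = int (OCPS (n + 1) (p + 1))"
  by (auto simp: OCPS_gf_def coeff_sum OCPS_eq_0)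

(* The ring Z[y] is not a field, so the library's division of power series is unavailable.
   A series with constant term 1 is a unit, and its inverse is fps_right_inverse _ 1. *)
definition fps_quotient :: "int poly fps \<Rightarrow> int poly fps \<Rightarrow> int poly fps" where
  "fps_quotient f g = f * fps_right_inverse g 1"

lemma eq_fps_quotient_iff:
  assumes "fps_nth g 0 = 1"
  shows "h = fps_quotient f g \<longleftrightarrow> h * g = f"
proof -
  have "g * fps_right_inverse g 1 = 1"
    by (rule fps_right_inverse) (simp add: assms)
  then have inv: "fps_right_inverse g 1 * g = 1"
    by (simp only: mult.commute)
  show ?thesis
  proof
    assume "h = fps_quotient f g"
    then show "h * g = f"
      by (simp only: fps_quotient_def mult.assoc inv mult_1_right)
  next
    assume "h * g = f"
    then have "fps_quotient f g = h * (g * fps_right_inverse g 1)"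
      by (simp only: fps_quotient_def mult.assoc [symmetric])
    then show "h = fps_quotient f g"
      by (simp only: \<open>g * fps_right_inverse g 1 = 1\<close> mult_1_right)
  qed
qed

abbreviation fps_x :: "int poly fps" where
  "fps_x \<equiv> fps_X"

abbreviation fps_y :: "int poly fps" where
  "fps_y \<equiv> fps_const [:0, 1:]"

end

theory Submission
  imports Defs
begin

text \<open>
  The proof removes the last block of a sequence. The first \<open>q\<close> blocks of an order-consecutive
  partition sequence of \<open>{1..m}\<close> into \<open>q + 1 \<ge> 2\<close> parts form an order-consecutive partition
  sequence of their union, which is a nonempty interval \<open>U\<close> properly contained in \<open>{1..m}\<close>;
  conversely, any such \<open>U\<close> and any such sequence of \<open>U\<close> can be completed in exactly one way, by the
  block \<open>{1..m} - U\<close>. An interval of length \<open>j\<close> has \<open>m - j + 1\<close> positions in \<open>{1..m}\<close>, and the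
  number of sequences depends on \<open>U\<close> only through its length (\<open>oc_sequences_interval\<close>). This gives
  \<open>OCPS m (q + 1) = (\<Sum>j=1..m-1. (m - j + 1) * OCPS j q)\<close> for \<open>q \<ge> 1\<close> (lemma \<open>OCPS_Suc_Suc\<close>),
  and a single part leaves no choice (\<open>OCPS_Suc_1\<close>).

  The sum is a convolution with the sequence \<open>0, 2, 3, 4, \<dots>\<close>, whose generating function is
  \<open>1/(1 - x)\<^sup>2 - 1 = (2x - x\<^sup>2)/(1 - x)\<^sup>2\<close>. So the recurrence says
  \<open>G = 1/(1 - x) + y G (2x - x\<^sup>2)/(1 - x)\<^sup>2\<close>, and multiplication by \<open>(1 - x)\<^sup>2\<close> gives the theorem.
\<close>

text \<open>
  The recursion passes from \<open>{1..m}\<close> to intervals that start elsewhere, so the ground set has to be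
  a parameter.
\<close>
definition oc_sequences :: "nat set \<Rightarrow> nat \<Rightarrow> nat set list set" where
  "oc_sequences A q = {ss. length ss = q \<and> (\<forall>i<q. ss ! i \<noteq> {}) \<and>
     (\<forall>i<q. \<forall>j<q. i \<noteq> j \<longrightarrow> ss ! i \<inter> ss ! j = {}) \<and> (\<Union>i<q. ss ! i) = A \<and>
     order_consecutive ss}"

lemma OCPS_eq_card: "OCPS m q = card (oc_sequences {1..m} q)"
  by (simp add: OCPS_def oc_sequences_def partition_sequence_def conj_assoc)

lemma finite_oc_sequences: "finite (oc_sequences {1..m} q)"
  by (rule finite_subset[OF _ finite_partition_sequences[of m q]])
     (auto simp: oc_sequences_def partition_sequence_def)

lemma oc_sequences_0: "oc_sequences A 0 = (if A = {} then {[]} else {})"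
  by (auto simp: oc_sequences_def order_consecutive_def)

lemma UN_oc_sequences: "ss \<in> oc_sequences A q \<Longrightarrow> (\<Union>i<q. ss ! i) = A"
  by (simp add: oc_sequences_def)

lemma consecutive_oc_sequences:
  assumes "ss \<in> oc_sequences A q" "q > 0"
  shows "consecutive_integers A"
proof -
  have "q \<in> {1..length ss}" and "A = (\<Union>i<q. ss ! i)" and "order_consecutive ss"
    using assms by (auto simp: oc_sequences_def)
  then show ?thesis by (simp only: order_consecutive_def)
qed

lemma nonempty_oc_sequences:
  assumes "ss \<in> oc_sequences A q" "q > 0"
  shows "A \<noteq> {}"
  using assms by (auto simp: oc_sequences_def)

section \<open>Translation of the ground set\<close>

lemma consecutive_integers_translation:
  "consecutive_integers ((+) a ` S) \<longleftrightarrow> consecutive_integers S"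
proof
  assume "consecutive_integers ((+) a ` S)"
  then obtain b c where bc: "(+) a ` S = {b..c}"
    by (auto simp: consecutive_integers_def)
  have S: "x \<in> S \<longleftrightarrow> b \<le> a + x \<and> a + x \<le> c" for x
  proof -
    have "x \<in> S \<longleftrightarrow> a + x \<in> (+) a ` S" by auto
    then show ?thesis by (simp add: bc)
  qed
  \<comment> \<open>Truncated subtraction would turn an upper end below \<open>a\<close> into \<open>0\<close>, which is why the empty
     set is a separate case.\<close>
  have "S = (if a \<le> c then {b - a..c - a} else {1..0})"
    by (auto simp: S)
  then show "consecutive_integers S"
    unfolding consecutive_integers_def by metis
next
  assume "consecutive_integers S"
  then show "consecutive_integers ((+) a ` S)"
    unfolding consecutive_integers_def by (metis image_add_atLeastAtMost)
qed

lemma map_translation_in_oc_sequences_iff: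
  "map ((`) ((+) a)) ts \<in> oc_sequences ((+) a ` A) q \<longleftrightarrow> ts \<in> oc_sequences A q"
proof (cases "length ts = q")
  case True
  have un: "(\<Union>i<k. map ((`) ((+) a)) ts ! i) = (+) a ` (\<Union>i<k. ts ! i)" if "k \<le> q" for k
    using that True by (auto simp: image_UN)
  have oc: "order_consecutive (map ((`) ((+) a)) ts) \<longleftrightarrow> order_consecutive ts"
    unfolding order_consecutive_def
    by (intro ball_cong)
       (simp_all only: length_map True atLeastAtMost_iff un consecutive_integers_translation)
  have disj: "(+) a ` S \<inter> (+) a ` T = {} \<longleftrightarrow> S \<inter> T = {}" for S T
    by (simp flip: image_Int)
  show ?thesis
    unfolding oc_sequences_def mem_Collect_eq oc un[OF order_refl]
    using True by (simp add: disj inj_image_eq_iff)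
next
  case False
  then show ?thesis by (simp add: oc_sequences_def)
qed

lemma oc_sequences_translation:
  "oc_sequences ((+) a ` A) q = map ((`) ((+) a)) ` oc_sequences A q"
proof (intro equalityI subsetI)
  fix ss assume ss: "ss \<in> oc_sequences ((+) a ` A) q"
  have "(+) a ` ((+) a -` B) = B" if "B \<in> set ss" for B
  proof -
    have "B \<subseteq> (+) a ` A"
      using ss that by (fastforce simp: oc_sequences_def in_set_conv_nth)
    then show ?thesis by auto
  qed
  then have "ss = map ((`) ((+) a)) (map ((-`) ((+) a)) ss)"
    by (simp add: map_idI)
  with ss show "ss \<in> map ((`) ((+) a)) ` oc_sequences A q"
    by (metis map_translation_in_oc_sequences_iff imageI)
qed (auto simp: map_translation_in_oc_sequences_iff)

lemma oc_sequences_interval: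
  "oc_sequences {Suc a..Suc (a + k)} q = map ((`) ((+) a)) ` oc_sequences {1..Suc k} q"
  using oc_sequences_translation[of a "{1..Suc k}" q] by (simp add: add.commute)

lemma finite_oc_sequences_interval: "finite (oc_sequences {Suc a..Suc (a + k)} q)"
  by (subst oc_sequences_interval) (rule finite_imageI[OF finite_oc_sequences])

lemma card_oc_sequences_interval:
  "card (oc_sequences {Suc a..Suc (a + k)} q) = OCPS (Suc k) q"
proof -
  have "inj (map ((`) ((+) a)))"
    by (rule inj_mapI) (simp add: inj_def inj_image_eq_iff)
  then show ?thesis
    unfolding OCPS_eq_card
    by (subst oc_sequences_interval) (rule card_image[OF inj_on_subset[OF _ subset_UNIV]])
qed

section \<open>The last block\<close>

text \<open>
  The unions of initial segments of \<open>ts @ [B]\<close> are those of \<open>ts\<close>, together with the whole of \<open>A\<close>. So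
  if the blocks cover an interval \<open>A\<close>, then \<open>ts @ [B]\<close> is order-consecutive exactly when \<open>ts\<close> is.
\<close>
lemma snoc_in_oc_sequences_iff:
  "ts @ [B] \<in> oc_sequences A (Suc q) \<longleftrightarrow>
     ts \<in> oc_sequences (A - B) q \<and> B \<noteq> {} \<and> B \<subseteq> A \<and> consecutive_integers A"
proof (cases "length ts = q")
  case True
  have un: "(\<Union>i<k. (ts @ [B]) ! i) = (\<Union>i<k. ts ! i)" if "k \<le> q" for k
    using that True by (auto simp: nth_append)
  have un': "(\<Union>i<Suc q. (ts @ [B]) ! i) = (\<Union>i<q. ts ! i) \<union> B"
    using un[of q] True by (auto simp: lessThan_Suc)
  have oc: "order_consecutive (ts @ [B]) \<longleftrightarrow>
      order_consecutive ts \<and> consecutive_integers ((\<Union>i<q. ts ! i) \<union> B)"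
    using True un un' by (auto simp: order_consecutive_def atLeastAtMostSuc_conv)
  have disj: "(\<forall>i<Suc q. \<forall>j<Suc q. i \<noteq> j \<longrightarrow> (ts @ [B]) ! i \<inter> (ts @ [B]) ! j = {}) \<longleftrightarrow>
      (\<forall>i<q. \<forall>j<q. i \<noteq> j \<longrightarrow> ts ! i \<inter> ts ! j = {}) \<and> (\<Union>i<q. ts ! i) \<inter> B = {}"
    using True by (simp add: All_less_Suc nth_append) blast
  have ne: "(\<forall>i<Suc q. (ts @ [B]) ! i \<noteq> {}) \<longleftrightarrow> (\<forall>i<q. ts ! i \<noteq> {}) \<and> B \<noteq> {}"
    using True by (auto simp: All_less_Suc nth_append)
  have compl: "U \<inter> B = {} \<and> U \<union> B = A \<longleftrightarrow> U = A - B \<and> B \<subseteq> A" for U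
    by blast
  have len: "length (ts @ [B]) = Suc q"
    using True by simp
  show ?thesis
    unfolding oc_sequences_def mem_Collect_eq oc disj ne un' len True
    using compl[of "\<Union>i<q. ts ! i"] by argo
next
  case False
  then show ?thesis by (simp add: oc_sequences_def)
qed

lemma OCPS_Suc_1: "OCPS (Suc n) 1 = 1"
proof -
  have "ss \<in> oc_sequences {1..Suc n} 1 \<longleftrightarrow> ss = [{1..Suc n}]" for ss
  proof (cases ss rule: rev_cases)
    case Nil
    then show ?thesis by (simp add: oc_sequences_def)
  next
    case (snoc ts B)
    have "consecutive_integers {1..Suc n}"
      unfolding consecutive_integers_def by blast
    then show ?thesis
      using snoc_in_oc_sequences_iff[of ts B "{1..Suc n}" 0] snoc
      by (auto simp: oc_sequences_0 split: if_splits)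
  qed
  then have "oc_sequences {1..Suc n} 1 = {[{1..Suc n}]}" by blast
  then show ?thesis by (simp add: OCPS_eq_card)
qed

text \<open>
  The fibre of the sequences over the union \<open>U\<close> of all blocks but the last is a copy of the
  sequences of \<open>U\<close>, and \<open>U\<close> runs over the nonempty proper subintervals of \<open>{1..n + 1}\<close>; the pair
  \<open>(k, a)\<close> stands for the one of length \<open>k + 1\<close> that starts at \<open>a + 1\<close>.
\<close>
lemma oc_sequences_Suc_Suc:
  "oc_sequences {1..Suc n} (Suc (Suc p)) =
     (\<Union>(k, a)\<in>(SIGMA k:{..<n}. {..n - k}).
        (\<lambda>ts. ts @ [{1..Suc n} - {Suc a..Suc (a + k)}]) `
          oc_sequences {Suc a..Suc (a + k)} (Suc p))"
    (is "?L = ?R")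
proof (intro equalityI subsetI)
  fix ss assume ss: "ss \<in> ?L"
  then have "ss \<noteq> []" by (auto simp: oc_sequences_def)
  then obtain ts B where ssB: "ss = ts @ [B]" by (metis append_butlast_last_id)
  let ?U = "{1..Suc n} - B"
  have ts: "ts \<in> oc_sequences ?U (Suc p)" and B: "B \<noteq> {}" "B \<subseteq> {1..Suc n}"
    using ss by (auto simp: ssB snoc_in_oc_sequences_iff)
  obtain b c where bc: "?U = {b..c}"
    using consecutive_oc_sequences[OF ts] by (auto simp: consecutive_integers_def)
  have le: "b \<le> c" using nonempty_oc_sequences[OF ts] bc by auto
  then have b: "b \<in> {1..Suc n}" and c: "c \<in> {1..Suc n}"
    using bc by (metis DiffD1 atLeastAtMost_iff order_refl)+
  have "c - b < n"
  proof (rule ccontr)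
    assume "\<not> c - b < n"
    then have "b = 1" "c = Suc n" using b c by auto
    then show False using bc B by blast
  qed
  moreover have "{Suc (b - 1)..Suc (b - 1 + (c - b))} = ?U"
    using bc b le by simp
  moreover have "B = {1..Suc n} - ?U" using B by auto
  ultimately show "ss \<in> ?R"
    using ts b c le by (intro UN_I[of "(c - b, b - 1)"]) (auto simp: ssB)
next
  fix ss assume "ss \<in> ?R"
  then obtain k a ts where ka: "k < n" "a \<le> n - k"
    and ts: "ts \<in> oc_sequences {Suc a..Suc (a + k)} (Suc p)"
    and ss: "ss = ts @ [{1..Suc n} - {Suc a..Suc (a + k)}]"
    by auto
  have sub: "{Suc a..Suc (a + k)} \<subseteq> {1..Suc n}" using ka by auto
  have "card {Suc a..Suc (a + k)} < card {1..Suc n}" using ka by simp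
  then have "{1..Suc n} - {Suc a..Suc (a + k)} \<noteq> {}"
    by (metis Diff_eq_empty_iff sub subset_antisym less_irrefl)
  moreover have "{1..Suc n} - ({1..Suc n} - {Suc a..Suc (a + k)}) = {Suc a..Suc (a + k)}"
    using sub by blast
  moreover have "consecutive_integers {1..Suc n}"
    unfolding consecutive_integers_def by blast
  ultimately show "ss \<in> ?L"
    using ts unfolding ss snoc_in_oc_sequences_iff by simp
qed

lemma OCPS_Suc_Suc:
  "OCPS (Suc n) (Suc (Suc p)) = (\<Sum>k<n. (n - k + 1) * OCPS (Suc k) (Suc p))"
proof -
  let ?I = "SIGMA k:{..<n}. {..n - k}"
  define F where "F = (\<lambda>(k, a). (\<lambda>ts. ts @ [{1..Suc n} - {Suc a..Suc (a + k)}]) `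
          oc_sequences {Suc a..Suc (a + k)} (Suc p))"
  have disj: "F i \<inter> F j = {}" if "i \<noteq> j" for i j
  proof -
    obtain k a l b where ij: "i = (k, a)" "j = (l, b)" by fastforce
    \<comment> \<open>A common element determines the list of its first blocks, hence their union.\<close>
    have "{Suc a..Suc (a + k)} = {Suc b..Suc (b + l)}" if common: "F i \<inter> F j \<noteq> {}"
    proof -
      obtain ss where "ss \<in> F (k, a)" and "ss \<in> F (l, b)"
        using common ij by blast
      then have A: "butlast ss \<in> oc_sequences {Suc a..Suc (a + k)} (Suc p)"
        and B: "butlast ss \<in> oc_sequences {Suc b..Suc (b + l)} (Suc p)"
        unfolding F_def by auto
      show ?thesis
        using UN_oc_sequences[OF A] UN_oc_sequences[OF B] by (simp only:)
    qed
    then have "i = j" if "F i \<inter> F j \<noteq> {}"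
      using that by (simp add: ij Icc_eq_Icc)
    then show ?thesis using \<open>i \<noteq> j\<close> by blast
  qed
  have card: "card (F (k, a)) = OCPS (Suc k) (Suc p)" for k a
    unfolding F_def prod.case by (subst card_image) (auto simp: inj_on_def card_oc_sequences_interval)
  have "OCPS (Suc n) (Suc (Suc p)) = card (\<Union>i\<in>?I. F i)"
    by (simp only: OCPS_eq_card oc_sequences_Suc_Suc F_def)
  also have "\<dots> = (\<Sum>i\<in>?I. card (F i))"
    using disj by (intro card_UN_disjoint)
      (auto simp: F_def finite_oc_sequences_interval)
  also have "\<dots> = (\<Sum>k<n. \<Sum>a\<le>n - k. card (F (k, a)))"
    by (subst sum.Sigma) auto
  also have "\<dots> = (\<Sum>k<n. (n - k + 1) * OCPS (Suc k) (Suc p))"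
    by (simp add: card)
  finally show ?thesis .
qed

section \<open>The generating function\<close>

text \<open>
  The factor \<open>y\<close>, which is \<open>[:0, 1:]\<close>, accounts for the removed block, and the summand \<open>1\<close> for the
  sequence with a single block, to which the recurrence does not apply.
\<close>
lemma nth_OCPS_gf:
  "fps_nth OCPS_gf n = 1 + [:0, 1:] * (\<Sum>k<n. fps_nth OCPS_gf k * of_nat (n - k + 1))"
proof (rule poly_eqI)
  fix p
  show "coeff (fps_nth OCPS_gf n) p =
    coeff (1 + [:0, 1:] * (\<Sum>k<n. fps_nth OCPS_gf k * of_nat (n - k + 1))) p"
  proof (cases p)
    case 0
    then show ?thesis using OCPS_Suc_1 by (simp add: coeff_OCPS_gf)
  next
    case (Suc r)
    have coeff: "coeff (fps_nth OCPS_gf k * of_nat c) r = int (c * OCPS (Suc k) (Suc r))" for k c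
      by (simp add: of_nat_poly coeff_OCPS_gf)
    have "coeff (1 + [:0, 1:] * (\<Sum>k<n. fps_nth OCPS_gf k * of_nat (n - k + 1))) p =
        coeff (\<Sum>k<n. fps_nth OCPS_gf k * of_nat (n - k + 1)) r"
      by (simp add: Suc)
    also have "\<dots> = int (OCPS (Suc n) (Suc (Suc r)))"
      by (simp only: coeff_sum coeff OCPS_Suc_Suc of_nat_sum)
    finally show ?thesis by (simp add: Suc coeff_OCPS_gf)
  qed
qed

lemma nth_mult_one_minus_fps_X:
  fixes f :: "'a::comm_ring_1 fps"
  shows "fps_nth (f * (1 - fps_X)) n = fps_nth f n - (if n = 0 then 0 else fps_nth f (n - 1))"
  by (simp add: right_diff_distrib)

theorem proposition4p3:
  shows "OCPS_gf =
    fps_quotient (1 - fps_x)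
      (1 - 2 * fps_x - 2 * fps_x * fps_y + fps_x ^ 2 + fps_x ^ 2 * fps_y)"
proof -
  \<comment> \<open>\<open>E\<close> is \<open>1/(1 - x)\<close>, and \<open>W\<close> is \<open>1/(1 - x)\<^sup>2 - 1\<close>; they are given by their coefficients because
     the recurrence provides these.\<close>
  define E where "E = (Abs_fps (\<lambda>_. 1) :: int poly fps)"
  define W where "W = (Abs_fps (\<lambda>d. if d = 0 then 0 else of_nat (d + 1)) :: int poly fps)"
  have E: "E * (1 - fps_x) = 1"
    by (rule fps_ext) (simp add: nth_mult_one_minus_fps_X E_def)
  have "W * (1 - fps_x) = E - 1 + fps_x"
    by (rule fps_ext) (auto simp: nth_mult_one_minus_fps_X W_def E_def)
  then have "W * (1 - fps_x) ^ 2 = (E - 1 + fps_x) * (1 - fps_x)"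
    by (simp only: power2_eq_square mult.assoc [symmetric])
  also have "\<dots> = E * (1 - fps_x) - (1 - fps_x) ^ 2"
    by (simp add: algebra_simps power2_eq_square)
  also have "\<dots> = 2 * fps_x - fps_x ^ 2"
    unfolding E by (simp add: algebra_simps power2_eq_square)
  finally have W: "W * (1 - fps_x) ^ 2 = 2 * fps_x - fps_x ^ 2" .
  have G: "OCPS_gf = E + fps_y * (OCPS_gf * W)"
  proof (rule fps_ext)
    fix n
    have "fps_nth (OCPS_gf * W) n = (\<Sum>k\<le>n. fps_nth OCPS_gf k * fps_nth W (n - k))"
      by (simp add: fps_mult_nth atLeast0AtMost)
    also have "\<dots> = (\<Sum>k<n. fps_nth OCPS_gf k * fps_nth W (n - k))"
      by (simp add: lessThan_Suc_atMost[symmetric] W_def)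
    also have "\<dots> = (\<Sum>k<n. fps_nth OCPS_gf k * of_nat (n - k + 1))"
      by (intro sum.cong) (auto simp: W_def)
    finally show "fps_nth OCPS_gf n = fps_nth (E + fps_y * (OCPS_gf * W)) n"
      using nth_OCPS_gf[of n] by (simp add: E_def)
  qed
  have "OCPS_gf * (1 - 2 * fps_x - 2 * fps_x * fps_y + fps_x ^ 2 + fps_x ^ 2 * fps_y) =
      OCPS_gf * (1 - fps_x) ^ 2 - fps_y * OCPS_gf * (2 * fps_x - fps_x ^ 2)"
    by (simp add: algebra_simps power2_eq_square)
  also have "\<dots> = (OCPS_gf - fps_y * (OCPS_gf * W)) * (1 - fps_x) ^ 2"
    unfolding W [symmetric] by (simp only: left_diff_distrib mult.assoc)
  also have "OCPS_gf - fps_y * (OCPS_gf * W) = E"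
    using G by (simp only: diff_eq_eq)
  also have "E * (1 - fps_x) ^ 2 = 1 - fps_x"
    by (simp only: power2_eq_square mult.assoc [symmetric] E mult_1)
  finally have "OCPS_gf * (1 - 2 * fps_x - 2 * fps_x * fps_y + fps_x ^ 2 + fps_x ^ 2 * fps_y) =
      1 - fps_x" .
  then show ?thesis
    by (subst eq_fps_quotient_iff) simp_all
qed

end
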